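(* For every integer $d\ge1$, $s\chi(d)\ge 2d$.
   Context: A graph $G=(V,E)$ is strongly $k$-colorable if every graph obtained from $G$ by adding to it (the edges of) a union of pairwise vertex-disjoint cliques, each of size at most $k$, on the vertex set $V$ is $k$-colorable. The strong chromatic number $s\chi(G)$ is the minimum $k$ such that $G$ is strongly $k$-colorable, and $s\chi(d)=\max s\chi(G)$ over all finite graphs $G$ with maximum degree at most $d$. *)

theory Defs
  imports "HOL-Library.Ramsey" "HOL-Library.Extended_Nat"
begin

text \<open>
  A simple graph is given by its vertex set \<open>V\<close> and its edge set \<open>E\<close>, a set of
  two-element subsets of \<open>V\<close> (\<open>nsets C 2\<close>, the set of all two-element subsets of \<open>C\<close>,
  is from \<open>HOL-Library.Ramsey\<close>).
\<close>

definition finite_graph :: "'a set \<Rightarrow> 'a set set \<Rightarrow> bool"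
  where "finite_graph V E \<longleftrightarrow> finite V \<and> E \<subseteq> nsets V 2"

definition degree :: "'a set set \<Rightarrow> 'a \<Rightarrow> nat"
  where "degree E v = card {e \<in> E. v \<in> e}"

definition max_degree_le :: "'a set \<Rightarrow> 'a set set \<Rightarrow> nat \<Rightarrow> bool"
  where "max_degree_le V E d \<longleftrightarrow> (\<forall>v\<in>V. degree E v \<le> d)"

definition colorable :: "'a set \<Rightarrow> 'a set set \<Rightarrow> nat \<Rightarrow> bool"
  where "colorable V E k \<longleftrightarrow>
    (\<exists>c \<in> V \<rightarrow> {..<k}. \<forall>u\<in>V. \<forall>v\<in>V. {u, v} \<in> E \<longrightarrow> c u \<noteq> c v)"

text \<open>\<open>P\<close> is the family of the vertex sets of the added cliques; it need not cover \<open>V\<close>.\<close>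

definition strongly_colorable :: "'a set \<Rightarrow> 'a set set \<Rightarrow> nat \<Rightarrow> bool"
  where "strongly_colorable V E k \<longleftrightarrow>
    (\<forall>P. pairwise disjnt P \<and> (\<forall>C\<in>P. C \<subseteq> V \<and> finite C \<and> card C \<le> k)
      \<longrightarrow> colorable V (E \<union> (\<Union>C\<in>P. nsets C 2)) k)"

definition strong_chromatic_number :: "'a set \<Rightarrow> 'a set set \<Rightarrow> nat"
  where "strong_chromatic_number V E = (LEAST k. strongly_colorable V E k)"

text \<open>
  The maximum over all finite graphs is taken as a supremum in the extended naturals, so that the
  definition does not presuppose that the strong chromatic numbers are bounded; if they are, the
  supremum is attained (\<open>max_strong_chromatic_number_attained\<close>). Taking the vertices to be
  natural numbers loses no finite graph (\<open>strong_chromatic_number_le_max\<close>).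
\<close>

definition max_strong_chromatic_number :: "nat \<Rightarrow> enat"
  where "max_strong_chromatic_number d =
    (SUP (V, E) \<in> {(V :: nat set, E). finite_graph V E \<and> max_degree_le V E d}.
      enat (strong_chromatic_number V E))"

lemma strongly_colorable_card:
  assumes "finite_graph V E"
  shows "strongly_colorable V E (card V)"
proof -
  have "finite V" using assms by (simp add: finite_graph_def)
  then obtain c where c: "bij_betw c V {..<card V}"
    using ex_bij_betw_finite_nat[of V] by (auto simp: lessThan_atLeast0)
  have col: "colorable V F (card V)" if "F \<subseteq> nsets V 2" for F
    unfolding colorable_def
  proof (intro bexI[of _ c] ballI impI)
    fix u v assume "u \<in> V" "v \<in> V" "{u, v} \<in> F"
    with that have "u \<noteq> v" by (auto simp: nsets_def)
    then show "c u \<noteq> c v"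
      using c \<open>u \<in> V\<close> \<open>v \<in> V\<close> by (meson bij_betw_imp_inj_on inj_onD)
  next
    show "c \<in> V \<rightarrow> {..<card V}"
      using c by (auto simp: bij_betw_def)
  qed
  show ?thesis
    unfolding strongly_colorable_def
  proof (intro allI impI, rule col)
    fix P assume "pairwise disjnt P \<and> (\<forall>C\<in>P. C \<subseteq> V \<and> finite C \<and> card C \<le> card V)"
    then show "E \<union> (\<Union>C\<in>P. nsets C 2) \<subseteq> nsets V 2"
      using assms by (auto simp: finite_graph_def nsets_def)
  qed
qed

lemma strongly_colorable_strong_chromatic_number:
  assumes "finite_graph V E"
  shows "strongly_colorable V E (strong_chromatic_number V E)"
  unfolding strong_chromatic_number_def
  by (rule LeastI[of "strongly_colorable V E", OF strongly_colorable_card[OF assms]])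

lemma max_strong_chromatic_number_attained:
  assumes "max_strong_chromatic_number d = enat m"
  shows "\<exists>(V :: nat set) E. finite_graph V E \<and> max_degree_le V E d
           \<and> strong_chromatic_number V E = m"
proof -
  let ?S = "(\<lambda>(V, E). enat (strong_chromatic_number V E)) `
              {(V :: nat set, E). finite_graph V E \<and> max_degree_le V E d}"
  have "finite_graph ({} :: nat set) {}" "max_degree_le ({} :: nat set) {} d"
    by (auto simp: finite_graph_def max_degree_le_def)
  then have ne: "?S \<noteq> {}" by blast
  have *: "enat m \<in> S" if "S \<noteq> {}" "Sup S = enat m" for S :: "enat set"
    using that Max_in[of S] by (metis Sup_enat_def enat.distinct(1))
  have "enat m \<in> ?S"
    by (rule *[OF ne]) (use assms in \<open>simp only: max_strong_chromatic_number_def\<close>)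
  then show ?thesis by auto
qed

lemma strong_chromatic_number_le_max:
  fixes V :: "'a set"
  assumes G: "finite_graph V E" "max_degree_le V E d"
  shows "enat (strong_chromatic_number V E) \<le> max_strong_chromatic_number d"
proof -
  have "finite V" and E: "E \<subseteq> nsets V 2"
    using G by (simp_all add: finite_graph_def)
  then obtain f :: "'a \<Rightarrow> nat" where f: "inj_on f V"
    using finite_imp_inj_to_nat_seg[of V] by auto
  have EV: "\<And>e. e \<in> E \<Longrightarrow> e \<subseteq> V" using E by (auto simp: nsets_def)
  let ?V = "f ` V" and ?E = "(`) f ` E"
  have G1: "finite_graph ?V ?E"
    unfolding finite_graph_def
  proof (intro conjI subsetI)
    fix x assume "x \<in> ?E"
    then obtain e where e: "e \<in> E" "x = f ` e" by blast
    then have "e \<in> nsets V 2" "inj_on f e"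
      using E EV f by (auto intro: inj_on_subset)
    then show "x \<in> nsets ?V 2"
      using e by (auto simp: nsets_def card_image)
  qed (use \<open>finite V\<close> in simp)
  have G2: "max_degree_le ?V ?E d"
    unfolding max_degree_le_def
  proof
    fix y assume "y \<in> ?V"
    then obtain v where v: "v \<in> V" "y = f v" by blast
    have "finite E" using E \<open>finite V\<close> by (meson finite_imp_finite_nsets finite_subset)
    have "{x \<in> ?E. y \<in> x} \<subseteq> (`) f ` {e \<in> E. v \<in> e}"
    proof
      fix x assume "x \<in> {x \<in> ?E. y \<in> x}"
      then obtain e where e: "e \<in> E" "x = f ` e" "f v \<in> f ` e" using v(2) by auto
      then have "v \<in> e" using inj_on_image_mem_iff[OF f v(1) EV[OF e(1)]] by simp
      then have "e \<in> {e \<in> E. v \<in> e}" using e(1) by simp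
      then show "x \<in> (`) f ` {e \<in> E. v \<in> e}" unfolding e(2) by (rule imageI)
    qed
    then have "card {x \<in> ?E. y \<in> x} \<le> card {e \<in> E. v \<in> e}"
      using \<open>finite E\<close> by (intro surj_card_le) auto
    also have "\<dots> \<le> d"
      using G(2) v by (simp add: max_degree_le_def degree_def)
    finally show "degree ?E y \<le> d" by (simp add: degree_def)
  qed
  have "strongly_colorable V E k" if k: "strongly_colorable ?V ?E k" for k
    unfolding strongly_colorable_def
  proof (intro allI impI)
    fix P assume P: "pairwise disjnt P \<and> (\<forall>C\<in>P. C \<subseteq> V \<and> finite C \<and> card C \<le> k)"
    have "pairwise disjnt ((`) f ` P)"
      unfolding pairwise_def
    proof (clarify)
      fix C D assume CD: "C \<in> P" "D \<in> P" "f ` C \<noteq> f ` D"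
      then have "C \<noteq> D" by blast
      with CD P have "C \<inter> D = {}" "C \<subseteq> V" "D \<subseteq> V"
        by (simp_all add: pairwise_def disjnt_def)
      then show "disjnt (f ` C) (f ` D)"
        using inj_on_image_Int[OF f, of C D] by (simp add: disjnt_def)
    qed
    moreover have "\<forall>C\<in>(`) f ` P. C \<subseteq> ?V \<and> finite C \<and> card C \<le> k"
    proof (clarify, intro conjI)
      fix C assume "C \<in> P"
      with P have C: "C \<subseteq> V" "finite C" "card C \<le> k" by simp_all
      show "f ` C \<subseteq> ?V" using C(1) by (rule image_mono)
      show "finite (f ` C)" using C(2) by simp
      show "card (f ` C) \<le> k" using card_image_le[OF C(2), of f] C(3) by linarith
    qed
    ultimately have "colorable ?V (?E \<union> (\<Union>C\<in>(`) f ` P. nsets C 2)) k"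
      using k unfolding strongly_colorable_def by meson
    then obtain c where c: "c \<in> ?V \<rightarrow> {..<k}"
      "\<forall>u\<in>?V. \<forall>v\<in>?V. {u, v} \<in> ?E \<union> (\<Union>C\<in>(`) f ` P. nsets C 2) \<longrightarrow> c u \<noteq> c v"
      unfolding colorable_def by (elim bexE)
    show "colorable V (E \<union> (\<Union>C\<in>P. nsets C 2)) k"
      unfolding colorable_def
    proof (intro bexI[of _ "c \<circ> f"] ballI impI)
      fix u v assume uv: "u \<in> V" "v \<in> V" "{u, v} \<in> E \<union> (\<Union>C\<in>P. nsets C 2)"
      have "{f u, f v} \<in> ?E \<union> (\<Union>C\<in>(`) f ` P. nsets C 2)"
      proof (cases "{u, v} \<in> E")
        case True
        then have "f ` {u, v} \<in> ?E" by (rule imageI)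
        then show ?thesis by simp
      next
        case False
        then obtain C where C: "C \<in> P" "{u, v} \<in> nsets C 2" using uv by blast
        then have "u \<noteq> v" "u \<in> C" "v \<in> C" by (auto simp: nsets_def)
        moreover have "f u \<noteq> f v" using \<open>u \<noteq> v\<close> uv f by (meson inj_onD)
        ultimately have "{f u, f v} \<in> nsets (f ` C) 2" by (auto simp: nsets_def)
        then show ?thesis using C by blast
      qed
      then show "(c \<circ> f) u \<noteq> (c \<circ> f) v"
        using c(2)[rule_format, of "f u" "f v"] uv by simp
    qed (use c(1) in auto)
  qed
  then have "strong_chromatic_number V E \<le> strong_chromatic_number ?V ?E"
    using strongly_colorable_strong_chromatic_number[OF G1]
    unfolding strong_chromatic_number_def by (meson Least_le)
  also have "enat (strong_chromatic_number ?V ?E) \<le> max_strong_chromatic_number d"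
    unfolding max_strong_chromatic_number_def
    using G1 G2 by (intro SUP_upper2[of "(?V, ?E)"]) auto
  finally show ?thesis by simp
qed

end

(* The extremal graph is K_{d,d}. If m <= min(k, d), then placing a clique on m vertices of each
   side is allowed by strong k-colorability, and together with the edges across it produces a
   complete graph on 2m vertices. For m = min(k, d) and 0 < k < 2d this exceeds k. All k < 2d
   have to be excluded here, because strong k-colorability is not obviously monotone in k. *)
theory Submission
  imports Defs
begin

definition complete_bipartite :: "'a set \<Rightarrow> 'a set \<Rightarrow> 'a set set" where
  "complete_bipartite A B = {{a, b} | a b. a \<in> A \<and> b \<in> B}"

lemma complete_bipartite_commute: "complete_bipartite A B = complete_bipartite B A"
  unfolding complete_bipartite_def by (auto simp: insert_commute)

lemma finite_graph_complete_bipartite: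
  assumes "finite A" "finite B" "A \<inter> B = {}"
  shows "finite_graph (A \<union> B) (complete_bipartite A B)"
proof -
  have "card {a, b} = 2" if "a \<in> A" "b \<in> B" for a b
  proof -
    have "a \<noteq> b"
      using that assms(3) by blast
    then show ?thesis by simp
  qed
  with assms(1,2) show ?thesis
    by (auto simp: finite_graph_def complete_bipartite_def nsets_def)
qed

text \<open>Disjointness forces \<open>v\<close> to be the \<open>A\<close>-end of every edge
  containing it, so such an edge is determined by its end in \<open>B\<close>. Vertices of
  \<open>B\<close> are later handled by swapping the two sides.\<close>

lemma degree_complete_bipartite_le:
  assumes "finite B" "A \<inter> B = {}" "v \<in> A"
  shows "degree (complete_bipartite A B) v \<le> card B"
proof -
  have "{e \<in> complete_bipartite A B. v \<in> e} \<subseteq> (\<lambda>b. {v, b}) ` B"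
    using assms by (auto simp: complete_bipartite_def)
  with \<open>finite B\<close> show ?thesis
    unfolding degree_def by (rule surj_card_le)
qed

lemma max_degree_le_complete_bipartite:
  assumes "finite A" "finite B" "A \<inter> B = {}" "card A \<le> d" "card B \<le> d"
  shows "max_degree_le (A \<union> B) (complete_bipartite A B) d"
  unfolding max_degree_le_def
proof
  fix v assume "v \<in> A \<union> B"
  then show "degree (complete_bipartite A B) v \<le> d"
  proof
    assume "v \<in> A"
    then show ?thesis
      using degree_complete_bipartite_le[of B A v] assms by auto
  next
    assume "v \<in> B"
    then show ?thesis
      using degree_complete_bipartite_le[of A B v] assms
      by (simp add: complete_bipartite_commute[of A B] Int_commute)
  qed
qed

text \<open>A proper coloring is injective on a clique, and only \<open>k\<close> colors are
  available.\<close>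

lemma card_clique_le_if_colorable:
  assumes "colorable V E k" "S \<subseteq> V" "nsets S 2 \<subseteq> E"
  shows "card S \<le> k"
proof -
  obtain c where c: "c \<in> V \<rightarrow> {..<k}" "\<forall>u\<in>V. \<forall>v\<in>V. {u, v} \<in> E \<longrightarrow> c u \<noteq> c v"
    using assms(1) unfolding colorable_def by blast
  have "inj_on c S"
  proof (rule inj_onI, rule ccontr)
    fix u v assume "u \<in> S" "v \<in> S" "c u = c v" "u \<noteq> v"
    then have "{u, v} \<in> E"
      using assms(3) by (auto simp: nsets_def)
    with c(2) \<open>u \<in> S\<close> \<open>v \<in> S\<close> \<open>c u = c v\<close> assms(2) show False by blast
  qed
  moreover have "c ` S \<subseteq> {..<k}"
    using c(1) assms(2) by blast
  ultimately show ?thesis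
    using card_inj_on_le[of c S "{..<k}"] by simp
qed

lemma not_strongly_colorable_complete_bipartite:
  assumes "A \<inter> B = {}" "card A = d" "card B = d" "k < 2 * d"
  shows "\<not> strongly_colorable (A \<union> B) (complete_bipartite A B) k"
proof
  assume sc: "strongly_colorable (A \<union> B) (complete_bipartite A B) k"
  let ?m = "min k d"
  obtain A' where A': "A' \<subseteq> A" "card A' = ?m" "finite A'"
    by (rule obtain_subset_with_card_n[of ?m A]) (simp add: assms(2))
  obtain B' where B': "B' \<subseteq> B" "card B' = ?m" "finite B'"
    by (rule obtain_subset_with_card_n[of ?m B]) (simp add: assms(3))
  have disj: "A' \<inter> B' = {}"
    using A'(1) B'(1) assms(1) by blast
  \<comment> \<open>If \<open>k = 0\<close>, both sets are empty and the family collapses to a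
    single member; this is harmless, since \<open>pairwise\<close> compares only distinct
    members.\<close>
  have "pairwise disjnt {A', B'}"
    using disj by (auto simp: pairwise_def disjnt_def)
  moreover have "\<forall>C\<in>{A', B'}. C \<subseteq> A \<union> B \<and> finite C \<and> card C \<le> k"
    using A' B' by auto
  ultimately have "pairwise disjnt {A', B'} \<and>
      (\<forall>C\<in>{A', B'}. C \<subseteq> A \<union> B \<and> finite C \<and> card C \<le> k)"
    by (rule conjI)
  then have
    col: "colorable (A \<union> B) (complete_bipartite A B \<union> (\<Union>C\<in>{A', B'}. nsets C 2)) k"
    by (rule sc[unfolded strongly_colorable_def, THEN spec, THEN mp])
  have "nsets (A' \<union> B') 2 \<subseteq> complete_bipartite A B \<union> (\<Union>C\<in>{A', B'}. nsets C 2)"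
  proof
    fix e assume e: "e \<in> nsets (A' \<union> B') 2"
    then obtain u v where uv: "e = {u, v}" "u \<noteq> v" "u \<in> A' \<union> B'" "v \<in> A' \<union> B'"
      by (auto simp: nsets_def card_2_iff)
    \<comment> \<open>Pairs inside one side are edges of an added clique; pairs across are edges of
      the bipartite graph, in either order of \<open>u\<close> and \<open>v\<close>.\<close>
    then consider "u \<in> A'" "v \<in> A'" | "u \<in> B'" "v \<in> B'"
      | "u \<in> A'" "v \<in> B'" | "v \<in> A'" "u \<in> B'"
      by blast
    then have "e \<in> nsets A' 2 \<or> e \<in> nsets B' 2 \<or> e \<in> complete_bipartite A' B'"
    proof cases
      case 1
      with uv show ?thesis by (simp add: nsets_def)
    next
      case 2
      with uv show ?thesis by (simp add: nsets_def)
    next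
      case 3
      with uv show ?thesis unfolding complete_bipartite_def by blast
    next
      case 4
      with uv show ?thesis unfolding complete_bipartite_def by blast
    qed
    moreover have "complete_bipartite A' B' \<subseteq> complete_bipartite A B"
      using A'(1) B'(1) unfolding complete_bipartite_def by blast
    ultimately show "e \<in> complete_bipartite A B \<union> (\<Union>C\<in>{A', B'}. nsets C 2)"
      by blast
  qed
  then have "card (A' \<union> B') \<le> k"
    by (rule card_clique_le_if_colorable[OF col Un_mono[OF A'(1) B'(1)]])
  then have "2 * ?m \<le> k"
    using card_Un_disjoint[OF A'(3) B'(3) disj] A'(2) B'(2) by simp
  \<comment> \<open>If the minimum were \<open>d\<close>, then 2d \<le> k would contradict
    \<open>k < 2 * d\<close>. So it is \<open>k\<close>, and 2k \<le> k leaves only zero.\<close>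
  with assms(4) have "k = 0" by linarith
  \<comment> \<open>For \<open>k = 0\<close> the clique count gives no contradiction. Instead,
    \<open>k < 2 * d\<close> makes \<open>d\<close> positive, so there is a vertex, and it cannot be
    colored from an empty palette.\<close>
  have "A \<noteq> {}"
    using assms(2,4) by auto
  then obtain a where "a \<in> A" by blast
  obtain c where "c \<in> A \<union> B \<rightarrow> {..<k}"
    using col unfolding colorable_def by (elim bexE)
  then have "c a \<in> {..<k}"
    using \<open>a \<in> A\<close> by (intro funcset_mem[of c "A \<union> B"] UnI1)
  with \<open>k = 0\<close> show False by simp
qed

theorem theorem7p4:
  fixes d :: nat
  assumes "d \<ge> 1"
  shows "max_strong_chromatic_number d \<ge> enat (2 * d)"
proof -
  define A B where "A = {..<d}" and "B = {d..<2 * d}"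
  let ?E = "complete_bipartite A B"
  have AB: "finite A" "finite B" "A \<inter> B = {}" "card A = d" "card B = d"
    by (auto simp: A_def B_def)
  have G: "finite_graph (A \<union> B) ?E" "max_degree_le (A \<union> B) ?E d"
    using AB by (simp_all add: finite_graph_complete_bipartite max_degree_le_complete_bipartite)
  have "2 * d \<le> strong_chromatic_number (A \<union> B) ?E"
  \<comment> \<open>The graph is strongly colorable with exactly its strong chromatic number of
    colors, so it suffices to apply the exclusion of all values below 2d to that one value.\<close>
  proof (rule leI, rule notI)
    assume "strong_chromatic_number (A \<union> B) ?E < 2 * d"
    from not_strongly_colorable_complete_bipartite[OF AB(3-5) this] show False
      using strongly_colorable_strong_chromatic_number[OF G(1)] by (rule notE)
  qed
  also have "enat (strong_chromatic_number (A \<union> B) ?E) \<le> max_strong_chromatic_number d"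
    using G by (rule strong_chromatic_number_le_max)
  finally show ?thesis by simp
qed

end
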